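(* Let $n\ge 1$ and $0\le k\le n-1$, let $\mathcal{A}$ be the $n$-dimensional null-filiform associative algebra over $\mathbb{C}$ with basis $e_1,\dots,e_n$, and let $P_k$ be a homogeneous operator of degree $k$ on $\mathcal{A}$ with associated function $\psi$, which is a Rota-Baxter operator of weight $1$. Then, for all $1\le i\le n$ and with $\psi(1)\in\mathbb{C}$: (a) If $k=0$, then $P_0(e_i)=\frac{\psi(1)^i}{(\psi(1)+1)^i-\psi(1)^i}\,e_i$. (b) If $1\le k<\lfloor n/2\rfloor$, then $P_k(e_i)=0$. (c) If $k\ge\lfloor n/2\rfloor$, then \[P_k(e_i)=\begin{cases}\psi(1)e_{1+k}, & i=1,\\ 0,&\text{otherwise.}\end{cases}\]
   Context: The $n$-dimensional null-filiform associative algebra $\mathcal{A}$ over $\mathbb{C}$ has basis $e_1,\dots,e_n$ and bilinear product $e_ie_j=e_{i+j}$ if $i+j\le n$, and $e_ie_j=0$ otherwise. A homogeneous operator of degree $k$ ($0\le k\le n-1$) on $\mathcal{A}$ is a linear map $P_k$ with $P_k(e_i)=\psi(i)e_{i+k}$ for $1\le i\le n-k$ and $P_k(e_i)=\psi(i)e_{i+k-n}$ for $n-k+1\le i\le n$, where $\psi:\mathbb{N}\to\mathbb{C}$ is a function. A Rota-Baxter operator of weight $\lambda$ is a linear map $P:\mathcal{A}\to\mathcal{A}$ with $P(x)P(y)=P(xP(y)+P(x)y+\lambda xy)$ for all $x,y\in\mathcal{A}$. *)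

theory Defs
  imports Complex_Main
begin

locale associative_algebra = vector_space scale
  for scale :: "'k::field \<Rightarrow> 'a::ab_group_add \<Rightarrow> 'a" (infixr "*s" 75) +
  fixes mult :: "'a \<Rightarrow> 'a \<Rightarrow> 'a" (infixl "\<bullet>" 70)
  assumes linear_mult_left: "Vector_Spaces.linear scale scale (\<lambda>x. x \<bullet> y)"
    and linear_mult_right: "Vector_Spaces.linear scale scale (\<lambda>y. x \<bullet> y)"
    and mult_assoc: "(x \<bullet> y) \<bullet> z = x \<bullet> (y \<bullet> z)"

text \<open>The basis is the family \<open>e 1, \<dots>, e n\<close>; the values of \<open>e\<close> at other indices are
  irrelevant.\<close>

locale null_filiform_algebra = associative_algebra scale mult
  for scale :: "complex \<Rightarrow> 'a::ab_group_add \<Rightarrow> 'a" (infixr "*s" 75)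
    and mult :: "'a \<Rightarrow> 'a \<Rightarrow> 'a" (infixl "\<bullet>" 70) +
  fixes n :: nat and e :: "nat \<Rightarrow> 'a"
  assumes basis_inj: "inj_on e {1..n}"
    and basis_independent: "independent (e ` {1..n})"
    and basis_span: "span (e ` {1..n}) = UNIV"
    and basis_mult: "\<lbrakk>i \<in> {1..n}; j \<in> {1..n}\<rbrakk> \<Longrightarrow>
      e i \<bullet> e j = (if i + j \<le> n then e (i + j) else 0)"

definition homogeneous_operator ::
  "(complex \<Rightarrow> 'a::ab_group_add \<Rightarrow> 'a) \<Rightarrow> nat \<Rightarrow> (nat \<Rightarrow> 'a) \<Rightarrow>
    nat \<Rightarrow> (nat \<Rightarrow> complex) \<Rightarrow> ('a \<Rightarrow> 'a) \<Rightarrow> bool" where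
  "homogeneous_operator scale n e k \<psi> P \<longleftrightarrow>
     Vector_Spaces.linear scale scale P \<and>
     (\<forall>i\<in>{1..n - k}. P (e i) = scale (\<psi> i) (e (i + k))) \<and>
     (\<forall>i\<in>{n - k + 1..n}. P (e i) = scale (\<psi> i) (e (i + k - n)))"

definition rota_baxter_operator ::
  "('k::field \<Rightarrow> 'a::ab_group_add \<Rightarrow> 'a) \<Rightarrow> ('a \<Rightarrow> 'a \<Rightarrow> 'a) \<Rightarrow>
    'k \<Rightarrow> ('a \<Rightarrow> 'a) \<Rightarrow> bool" where
  "rota_baxter_operator scale mult w P \<longleftrightarrow>
     Vector_Spaces.linear scale scale P \<and>
     (\<forall>x y. mult (P x) (P y) = P (mult x (P y) + mult (P x) y + scale w (mult x y)))"

end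

theory Submission imports Defs
begin

text \<open>The Rota-Baxter identity is tested on pairs of basis vectors. For \<open>k = 0\<close> it becomes the recurrence
  \<open>\<psi> i * \<psi> j = \<psi> (i + j) * (\<psi> i + \<psi> j + 1)\<close>, which is solved from \<open>\<psi> 1\<close> by taking \<open>j = 1\<close>.
  For \<open>k > 0\<close>, grade the algebra by residues modulo \<open>n\<close>: the weight term \<open>P (e\<^sub>i e\<^sub>j)\<close> has degree
  \<open>i + j + k\<close>, while all other terms have degree \<open>i + j + 2k\<close>, so \<open>\<psi> (i + j) = 0\<close>. Only \<open>\<psi> 1\<close> survives, and
  the pair \<open>(e\<^sub>1, e\<^sub>1)\<close> then forces \<open>\<psi> 1 ^ 2 = 0\<close> whenever \<open>2 + 2k \<le> n\<close>.\<close>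

context null_filiform_algebra
begin

text \<open>A linear functional: applying it to a vector identity such as the Rota-Baxter identity
  leaves a scalar equation in \<psi>.\<close>

definition coord :: "nat \<Rightarrow> 'a \<Rightarrow> complex" where
  "coord m x = representation (e ` {1..n}) x (e m)"

lemma coord_add: "coord m (x + y) = coord m x + coord m y"
  unfolding coord_def using representation_add[OF basis_independent] basis_span by simp

lemma coord_scale: "coord m (c *s x) = c * coord m x"
  unfolding coord_def using representation_scale[OF basis_independent] basis_span by simp

lemma coord_zero: "coord m 0 = 0"
  unfolding coord_def using representation_zero by simp

lemma coord_basis:
  assumes "i \<in> {1..n}" "m \<in> {1..n}"
  shows "coord m (e i) = (if i = m then 1 else 0)"
proof -
  have "e i = e m \<longleftrightarrow> i = m"
    using assms basis_inj by (auto dest: inj_onD)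
  then show ?thesis
    unfolding coord_def using assms representation_basis[OF basis_independent, of "e i"] by auto
qed

lemma mult_scale_left: "(c *s x) \<bullet> y = c *s (x \<bullet> y)"
  using linear_mult_left[of y] by (simp add: Vector_Spaces.linear_iff)

lemma mult_scale_right: "x \<bullet> (c *s y) = c *s (x \<bullet> y)"
  using linear_mult_right[of x] by (simp add: Vector_Spaces.linear_iff)

end

text \<open>Merges the two branches of \<open>homogeneous_operator\<close>: for \<open>k < n\<close>
  and \<open>i\<close> in \<open>{1..n}\<close> this is the representative of \<open>i + k\<close>
  modulo \<open>n\<close> in \<open>{1..n}\<close>.\<close>

definition cyclic_shift :: "nat \<Rightarrow> nat \<Rightarrow> nat \<Rightarrow> nat" where
  "cyclic_shift n k i = (if i + k \<le> n then i + k else i + k - n)"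

lemma cyclic_shift_0: "i \<le> n \<Longrightarrow> cyclic_shift n 0 i = i"
  by (simp add: cyclic_shift_def)

lemma cyclic_shift_in:
  assumes "k < n" "i \<in> {1..n}"
  shows "cyclic_shift n k i \<in> {1..n}"
  using assms by (auto simp: cyclic_shift_def)

lemma cyclic_shift_neq:
  assumes "1 \<le> k" "k < n"
  shows "cyclic_shift n k i \<noteq> i"
  using assms by (auto simp: cyclic_shift_def)

lemma cyclic_shift_inject:
  assumes "k < n" "i \<in> {1..n}" "j \<in> {1..n}" "cyclic_shift n k i = cyclic_shift n k j"
  shows "i = j"
  using assms by (auto simp: cyclic_shift_def split: if_splits)

text \<open>Modulo \<open>n\<close> the two sides are \<open>i + j + 2 * k\<close> and
  \<open>i + j + k\<close>; they differ by \<open>k\<close>, which is not a multiple of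
  \<open>n\<close>.\<close>

lemma cyclic_shift_add_neq:
  assumes "1 \<le> k" "k < n"
  shows "cyclic_shift n k i + cyclic_shift n k j \<noteq> cyclic_shift n k (i + j)"
  using assms by (auto simp: cyclic_shift_def)

locale homogeneous_rota_baxter = null_filiform_algebra scale mult n e
  for scale :: "complex \<Rightarrow> 'a::ab_group_add \<Rightarrow> 'a" (infixr "*s" 75)
    and mult :: "'a \<Rightarrow> 'a \<Rightarrow> 'a" (infixl "\<bullet>" 70)
    and n :: nat and e :: "nat \<Rightarrow> 'a" +
  fixes k :: nat and \<psi> :: "nat \<Rightarrow> complex" and P :: "'a \<Rightarrow> 'a"
  assumes degree_less: "k < n"
    and homogeneous: "homogeneous_operator scale n e k \<psi> P"
    and rota_baxter: "rota_baxter_operator scale mult 1 P"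
begin

abbreviation s where "s \<equiv> cyclic_shift n k"

lemma P_linear: "Vector_Spaces.linear scale scale P"
  using homogeneous by (simp add: homogeneous_operator_def)

lemma P_add: "P (x + y) = P x + P y"
  and P_scale: "P (c *s x) = c *s P x"
  using P_linear by (simp_all add: Vector_Spaces.linear_iff)

lemma P_zero: "P 0 = 0"
  using P_scale[of 0 0] by simp

lemma P_basis:
  assumes "i \<in> {1..n}"
  shows "P (e i) = \<psi> i *s e (s i)"
  using assms homogeneous degree_less
  by (cases "i + k \<le> n") (auto simp: homogeneous_operator_def cyclic_shift_def)

lemma rota_baxter_basis:
  assumes "i \<in> {1..n}" "j \<in> {1..n}"
  shows "(\<psi> i * \<psi> j) *s (e (s i) \<bullet> e (s j)) =
    \<psi> j *s P (e i \<bullet> e (s j)) + \<psi> i *s P (e (s i) \<bullet> e j) + P (e i \<bullet> e j)"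
proof -
  have "P (e i) \<bullet> P (e j) = P (e i \<bullet> P (e j) + P (e i) \<bullet> e j + 1 *s (e i \<bullet> e j))"
    using rota_baxter by (auto simp: rota_baxter_operator_def)
  then show ?thesis
    using assms
    by (simp add: P_basis mult_scale_left mult_scale_right P_add P_scale mult.commute)
qed

text \<open>The product is zero or \<open>e (i + j)\<close>, so \<open>P\<close> sends it to a
  multiple of \<open>e (s (i + j))\<close> at most, and \<open>s\<close> is injective on
  \<open>{1..n}\<close>.\<close>

lemma coord_P_mult:
  assumes "i \<in> {1..n}" "j \<in> {1..n}" "m \<in> {1..n}" "i + j \<noteq> m"
  shows "coord (s m) (P (e i \<bullet> e j)) = 0"
proof (cases "i + j \<le> n")
  case True
  then have ij: "i + j \<in> {1..n}"
    using assms by auto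
  then have "s (i + j) \<noteq> s m"
    using assms cyclic_shift_inject[OF degree_less] by blast
  then show ?thesis
    using True ij assms cyclic_shift_in[OF degree_less]
    by (simp add: basis_mult P_basis coord_scale coord_basis del: atLeastAtMost_iff)
next
  case False
  then show ?thesis
    using assms by (simp add: basis_mult P_zero coord_zero)
qed

lemma symbol_add_eq_0:
  assumes "1 \<le> k" "1 \<le> i" "1 \<le> j" "i + j \<le> n"
  shows "\<psi> (i + j) = 0"
proof -
  have ij: "i \<in> {1..n}" "j \<in> {1..n}" "i + j \<in> {1..n}"
    using assms by auto
  note in_range = ij ij[THEN cyclic_shift_in[OF degree_less]]
  have lhs: "coord (s (i + j)) (e (s i) \<bullet> e (s j)) = 0"
  proof (cases "s i + s j \<le> n")
    case True
    then have "s i + s j \<in> {1..n}"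
      using in_range by auto
    then show ?thesis
      using True in_range cyclic_shift_add_neq[OF assms(1) degree_less, of i j]
      by (simp add: basis_mult coord_basis del: atLeastAtMost_iff)
  next
    case False
    then show ?thesis
      using in_range by (simp add: basis_mult coord_zero del: atLeastAtMost_iff)
  qed
  \<comment> \<open>A nontrivial shift fixes no index, so neither mixed product can contribute to
    the coordinate at \<open>s (i + j)\<close>; only the weight term is left there.\<close>
  have "i + s j \<noteq> i + j" "s i + j \<noteq> i + j"
    using cyclic_shift_neq[OF assms(1) degree_less] by auto
  then have rhs: "coord (s (i + j)) (P (e i \<bullet> e (s j))) = 0"
    "coord (s (i + j)) (P (e (s i) \<bullet> e j)) = 0"
    using in_range by (blast intro: coord_P_mult)+
  have "coord (s (i + j)) (P (e i \<bullet> e j)) = \<psi> (i + j)"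
    using in_range assms by (simp add: basis_mult P_basis coord_scale coord_basis del: atLeastAtMost_iff)
  then show ?thesis
    using arg_cong[OF rota_baxter_basis[OF ij(1,2)], of "coord (s (i + j))"] lhs rhs
    by (simp add: coord_add coord_scale)
qed

lemma symbol_eq_0:
  assumes "1 \<le> k" "2 \<le> i" "i \<le> n"
  shows "\<psi> i = 0"
  using symbol_add_eq_0[of "i - 1" 1] assms by simp

lemma symbol_1_eq_0:
  assumes "1 \<le> k" "k < n div 2"
  shows "\<psi> 1 = 0"
proof -
  have n: "2 + 2 * k \<le> n"
    using assms by linarith
  then have s1: "s (Suc 0) = Suc k"
    by (simp add: cyclic_shift_def)
  \<comment> \<open>These are the factors that \<open>P\<close> produces on the right-hand side:
    both mixed products equal \<open>e (2 + k)\<close>, and the weight term is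
    \<open>P (e 2)\<close>. On the left, \<open>e (1 + k)\<close> squared is
    \<open>e (2 + 2 * k)\<close>, which is nonzero by the bound on \<open>k\<close>.\<close>
  have "\<psi> (2 + k) = 0" "\<psi> 2 = 0"
    using n assms by (auto intro!: symbol_eq_0)
  then have "(\<psi> 1 * \<psi> 1) *s e (2 + 2 * k) = 0"
    using n rota_baxter_basis[of 1 1]
    by (simp add: s1 basis_mult P_basis mult_2 numeral_2_eq_2)
  from arg_cong[OF this, of "coord (2 + 2 * k)"] show ?thesis
    using n by (simp add: coord_scale coord_zero coord_basis)
qed

lemma symbol_recurrence:
  assumes "k = 0" "1 \<le> i" "1 \<le> j" "i + j \<le> n"
  shows "\<psi> i * \<psi> j = \<psi> (i + j) * (\<psi> i + \<psi> j + 1)"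
proof -
  have "(\<psi> i * \<psi> j) *s e (i + j) = (\<psi> (i + j) * (\<psi> i + \<psi> j + 1)) *s e (i + j)"
    using rota_baxter_basis[of i j] assms
    by (simp add: cyclic_shift_0 basis_mult P_basis scale_left_distrib algebra_simps)
  from arg_cong[OF this, of "coord (i + j)"] show ?thesis
    using assms by (simp add: coord_scale coord_basis)
qed

text \<open>The denominator is shown nonzero in the same induction: the step must divide by it, and
  since \<open>x / 0 = 0\<close> the formula alone would not exclude a zero denominator.\<close>

lemma symbol_closed_form:
  assumes "k = 0" "1 \<le> i" "i \<le> n"
  shows "(\<psi> 1 + 1) ^ i - \<psi> 1 ^ i \<noteq> 0 \<and> \<psi> i = \<psi> 1 ^ i / ((\<psi> 1 + 1) ^ i - \<psi> 1 ^ i)"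
  using assms(2,3)
proof (induction i rule: dec_induct)
  case base
  then show ?case by simp
next
  case (step i)
  define p d d' where "p = \<psi> 1" and "d = (p + 1) ^ i - p ^ i"
    and "d' = (p + 1) ^ Suc i - p ^ Suc i"
  have IH: "d \<noteq> 0" "\<psi> i = p ^ i / d"
    using step by (simp_all add: p_def d_def)
  have "\<psi> i * p = \<psi> (Suc i) * (\<psi> i + p + 1)"
    using symbol_recurrence[of i 1] assms(1) step by (simp add: p_def)
  \<comment> \<open>The numerator telescopes:
    \<open>p ^ i + (p + 1) * d = (p + 1) ^ Suc i - p ^ Suc i\<close>.\<close>
  moreover have "\<psi> i + p + 1 = d' / d"
    using IH by (simp add: field_simps) (simp add: d_def d'_def algebra_simps)
  ultimately have eq: "p ^ Suc i = \<psi> (Suc i) * d'"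
    using IH by (simp add: mult.commute)
  have "d' \<noteq> 0"
  proof
    assume "d' = 0"
    \<comment> \<open>A zero denominator would force \<open>p ^ Suc i = 0\<close>; but at
      \<open>p = 0\<close> the denominator is 1.\<close>
    with eq have "p = 0" by auto
    with \<open>d' = 0\<close> show False by (simp add: d'_def)
  qed
  with eq have "\<psi> (Suc i) = p ^ Suc i / d'"
    by (simp add: field_simps)
  with \<open>d' \<noteq> 0\<close> show ?case
    by (simp add: p_def d'_def)
qed

end

theorem theorem3p8:
  fixes scale :: "complex \<Rightarrow> 'a::ab_group_add \<Rightarrow> 'a"
    and mult :: "'a \<Rightarrow> 'a \<Rightarrow> 'a"
    and n k :: nat
    and e :: "nat \<Rightarrow> 'a"
    and \<psi> :: "nat \<Rightarrow> complex"
    and P :: "'a \<Rightarrow> 'a"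
  assumes "1 \<le> n" and "k \<le> n - 1"
    and "null_filiform_algebra scale mult n e"
    and "homogeneous_operator scale n e k \<psi> P"
    and "rota_baxter_operator scale mult 1 P"
  shows "(k = 0 \<longrightarrow> (\<forall>i\<in>{1..n}.
            (\<psi> 1 + 1) ^ i - \<psi> 1 ^ i \<noteq> 0 \<and>
            P (e i) = scale (\<psi> 1 ^ i / ((\<psi> 1 + 1) ^ i - \<psi> 1 ^ i)) (e i)))
       \<and> (1 \<le> k \<and> k < n div 2 \<longrightarrow> (\<forall>i\<in>{1..n}. P (e i) = 0))
       \<and> (n div 2 \<le> k \<longrightarrow> (\<forall>i\<in>{1..n}.
            P (e i) = (if i = 1 then scale (\<psi> 1) (e (1 + k)) else 0)))"
proof -
  interpret homogeneous_rota_baxter scale mult n e k \<psi> P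
    using assms by (intro homogeneous_rota_baxter.intro homogeneous_rota_baxter_axioms.intro) auto
  have high: "P (e i) = 0" if "1 \<le> k" "2 \<le> i" "i \<le> n" for i
    using that symbol_eq_0 P_basis by simp
  show ?thesis
  proof (intro conjI[OF _ conjI] impI ballI)
    fix i assume "k = 0" "i \<in> {1..n}"
    then show "(\<psi> 1 + 1) ^ i - \<psi> 1 ^ i \<noteq> 0 \<and>
        P (e i) = scale (\<psi> 1 ^ i / ((\<psi> 1 + 1) ^ i - \<psi> 1 ^ i)) (e i)"
      using symbol_closed_form[of i] P_basis[of i] cyclic_shift_0[of i n] by simp
  next
    fix i assume "1 \<le> k \<and> k < n div 2" "i \<in> {1..n}"
    then show "P (e i) = 0"
      using high[of i] symbol_1_eq_0 P_basis[of i] by (cases "i = 1") auto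
  next
    fix i assume k: "n div 2 \<le> k" and i: "i \<in> {1..n}"
    \<comment> \<open>If \<open>k = 0\<close>, then \<open>n div 2 = 0\<close> leaves only
      \<open>n = 1\<close>, where the sole index is 1.\<close>
    have "1 \<le> k" if "i \<noteq> 1"
      using that k i by auto
    then show "P (e i) = (if i = 1 then scale (\<psi> 1) (e (1 + k)) else 0)"
      using i high[of i] P_basis[of i] degree_less by (auto simp: cyclic_shift_def)
  qed
qed

end
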